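(* There is a unique function $\operatorname{gdet}$, defined on the set of all real $m\times n$ matrices with $m\ge n\ge 1$ (all such sizes $m,n$ simultaneously) and taking real values, that satisfies both of the following conditions: (i) (base case) for every $m\ge 1$ and every $m\times 1$ matrix $(a_1,\ldots,a_m)^T$, $$\operatorname{gdet}\,(a_1,\ldots,a_m)^T = a_1-a_2+\cdots+(-1)^{m+1}a_m;$$ (ii) (Laplace expansion along the first column) for all $m\ge n\ge 2$ and every $m\times n$ matrix $A=(a_{ij})$, $$\operatorname{gdet} A = \sum_{i=1}^m (-1)^{i+1}\, a_{i1}\, \operatorname{gdet} A_{\{i\}^C}^{\{1\}^C},$$ where $A_{\{i\}^C}^{\{1\}^C}$ is the $(m-1)\times(n-1)$ matrix obtained from $A$ by deleting row $i$ and column $1$. Moreover, this unique function is given, for every real $m\times n$ matrix $A$ with $m\ge n\ge 1$, by $$\operatorname{gdet} A = \sum_{1\le i_1<i_2<\cdots<i_n\le m} (-1)^{\sum_{j=1}^n (i_j+j)}\,\det A_{i_1,\ldots,i_n},$$ where $A_{i_1,\ldots,i_n}$ denotes the $n\times n$ submatrix of $A$ consisting of the rows $i_1,\ldots,i_n$ in this order.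
   Context: When rows or columns of a matrix are deleted, the remaining rows and columns keep their relative order and are re-indexed starting from $1$. In particular, the recursion in condition (ii) is applied to the re-indexed $(m-1)\times(n-1)$ submatrix. *)

theory Defs
  imports "Jordan_Normal_Form.Determinant" "HOL-Library.FuncSet"
begin

text \<open>Matrices and their rows and columns are indexed from 0, so the 1-based row number of row
  \<open>i\<close> is \<open>Suc i\<close>; the signs below are written in terms of the 1-based numbers.\<close>

definition tall_mats :: "real mat set" where
  "tall_mats = {A. 1 \<le> dim_col A \<and> dim_col A \<le> dim_row A}"

definition gdet_base :: "(real mat \<Rightarrow> real) \<Rightarrow> bool" where
  "gdet_base f \<longleftrightarrow>
     (\<forall>m \<ge> 1. \<forall>A \<in> carrier_mat m 1. f A = (\<Sum>i<m. (-1) ^ (Suc i + 1) * A $$ (i, 0)))"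

definition gdet_laplace :: "(real mat \<Rightarrow> real) \<Rightarrow> bool" where
  "gdet_laplace f \<longleftrightarrow>
     (\<forall>m n. m \<ge> n \<longrightarrow> n \<ge> 2 \<longrightarrow> (\<forall>A \<in> carrier_mat m n.
        f A = (\<Sum>i<m. (-1) ^ (Suc i + 1) * A $$ (i, 0) * f (mat_delete A i 0))))"

text \<open>A function with domain \<^const>\<open>tall_mats\<close> is represented by a total function that is
  \<^const>\<open>undefined\<close> elsewhere, so that equality of such functions is equality on the domain.\<close>

definition is_gdet :: "(real mat \<Rightarrow> real) \<Rightarrow> bool" where
  "is_gdet f \<longleftrightarrow> f \<in> tall_mats \<rightarrow>\<^sub>E UNIV \<and> gdet_base f \<and> gdet_laplace f"

definition row_selections :: "nat \<Rightarrow> nat \<Rightarrow> nat list set" where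
  "row_selections m n = {ks. length ks = n \<and> set ks \<subseteq> {..<m} \<and> sorted_wrt (<) ks}"

definition select_rows :: "real mat \<Rightarrow> nat list \<Rightarrow> real mat" where
  "select_rows A ks = mat_of_rows (dim_col A) (map (row A) ks)"

end

theory Submission
  imports Defs
begin

text \<open>Uniqueness is induction on the number of columns. For existence, take the sum of the signed
  maximal minors and expand each minor along its first column: this gives a sum over pairs of a
  row selection \<open>ks\<close> and a position \<open>j\<close> in it. Removing the chosen row \<open>i = ks ! j\<close> and re-indexing
  the remaining ones puts these pairs in bijection with the pairs of a row \<open>i < m\<close> and a row
  selection for the matrix without row \<open>i\<close>, and the signs agree.\<close>

section \<open>The signed sum of maximal minors, and re-indexing of row selections\<close>

definition minor_sum :: "real mat \<Rightarrow> real" where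
  "minor_sum A = (\<Sum>ks \<in> row_selections (dim_row A) (dim_col A).
     (-1) ^ (\<Sum>j<dim_col A. Suc (ks ! j) + Suc j) * det (select_rows A ks))"

text \<open>In an increasing \<open>ks\<close>, the entries after position \<open>j\<close> are rows
  that move up by one when row \<open>ks ! j\<close> is deleted; the earlier ones keep their
  number.\<close>

definition remove_row :: "nat \<Rightarrow> nat list \<Rightarrow> nat list" where
  "remove_row j ks = take j ks @ map (\<lambda>k. k - 1) (drop (Suc j) ks)"

text \<open>The place of \<open>i\<close> is read off from an increasing \<open>ls\<close>: entries
  below \<open>i\<close> are rows preceding the deleted one, while entries from \<open>i\<close> on
  are rows that moved up by one, which \<open>Suc\<close> undoes.\<close>

definition insert_row :: "nat \<Rightarrow> nat list \<Rightarrow> nat list" where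
  "insert_row i ls = takeWhile (\<lambda>k. k < i) ls @ i # map Suc (dropWhile (\<lambda>k. k < i) ls)"

lemma row_selectionsD:
  assumes "ks \<in> row_selections m n"
  shows "length ks = n" "\<And>j. j < n \<Longrightarrow> ks ! j < m"
  using assms by (auto simp: row_selections_def dest!: subsetD intro: nth_mem)

lemma row_selections_one: "row_selections m 1 = (\<lambda>i. [i]) ` {..<m}"
  by (auto simp: row_selections_def length_Suc_conv)

text \<open>Splitting around position \<open>j\<close> trades index arithmetic for concatenation;
  strict sortedness puts \<open>xs\<close> below \<open>i\<close> and \<open>ys\<close> above
  it.\<close>

lemma split_row_selection:
  assumes "ks \<in> row_selections m n" "j < n"
  obtains xs i ys where "ks = xs @ i # ys" "length xs = j" "i = ks ! j"
    "remove_row j ks = xs @ map (\<lambda>k. k - 1) ys"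
    "\<forall>x\<in>set xs. x < i" "\<forall>y\<in>set ys. i < y"
    "sorted_wrt (<) xs" "sorted_wrt (<) ys" "i < m" "set xs \<subseteq> {..<m}" "set ys \<subseteq> {..<m}"
proof -
  have l: "length ks = n" using assms by (simp add: row_selections_def)
  define xs i ys where d: "xs = take j ks" "i = ks ! j" "ys = drop (Suc j) ks"
  have k: "ks = xs @ i # ys" using l assms by (simp add: d id_take_nth_drop)
  have "set (xs @ i # ys) \<subseteq> {..<m}" "sorted_wrt (<) (xs @ i # ys)"
    using assms unfolding k[symmetric] by (auto simp: row_selections_def)
  moreover have "length xs = j" "remove_row j ks = xs @ map (\<lambda>k. k - 1) ys"
    using l assms by (simp_all add: d remove_row_def)
  ultimately show ?thesis
    by (intro that[of xs i ys] k d(2)) (simp_all add: sorted_wrt_append)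
qed

lemma remove_row_mem:
  assumes "ks \<in> row_selections m n" "j < n"
  shows "remove_row j ks \<in> row_selections (m - 1) (n - 1)"
proof -
  obtain xs i ys where s: "ks = xs @ i # ys" "length xs = j" "i = ks ! j"
    "remove_row j ks = xs @ map (\<lambda>k. k - 1) ys"
    "\<forall>x\<in>set xs. x < i" "\<forall>y\<in>set ys. i < y"
    "sorted_wrt (<) xs" "sorted_wrt (<) ys" "i < m" "set xs \<subseteq> {..<m}" "set ys \<subseteq> {..<m}"
    by (rule split_row_selection[OF assms]) (rule that; assumption)
  have "length ks = n" using assms by (simp add: row_selections_def)
  then have l: "length (remove_row j ks) = n - 1" unfolding s(4) by (simp add: s(1))
  have r: "set (remove_row j ks) \<subseteq> {..<m - 1}"
    unfolding s(4) using s(5,6,9,11) by fastforce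
  \<comment> \<open>Truncated predecessor is strictly monotone on positive numbers only; entries of
    \<open>ys\<close> exceed \<open>i\<close>, hence are positive.\<close>
  have "sorted_wrt (<) (map (\<lambda>k. k - 1) ys)"
    unfolding sorted_wrt_map
    by (rule sorted_wrt_mono_rel[OF _ s(8)]) (use s(6) in force)
  \<comment> \<open>Across the junction, \<open>x < i \<le> y - 1\<close> for \<open>x\<close> in
    \<open>xs\<close> and \<open>y\<close> in \<open>ys\<close>.\<close>
  then have "sorted_wrt (<) (remove_row j ks)"
    unfolding s(4) sorted_wrt_append using s(5-7) by fastforce
  with l r show ?thesis by (simp add: row_selections_def)
qed

lemma insert_row_remove_row:
  assumes "ks \<in> row_selections m n" "j < n"
  shows "insert_row (ks ! j) (remove_row j ks) = ks"
    and "length (takeWhile (\<lambda>k. k < ks ! j) (remove_row j ks)) = j"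
proof -
  obtain xs i ys where s: "ks = xs @ i # ys" "length xs = j" "i = ks ! j"
    "remove_row j ks = xs @ map (\<lambda>k. k - 1) ys"
    "\<forall>x\<in>set xs. x < i" "\<forall>y\<in>set ys. i < y"
    by (rule split_row_selection[OF assms]) (rule that; assumption)
  \<comment> \<open>Lowering \<open>y > i\<close> leaves \<open>y - 1 \<ge> i\<close>, so the first
    lowered entry already fails the test and the cut falls exactly behind \<open>xs\<close>.\<close>
  have "takeWhile (\<lambda>k. k < i) (map (\<lambda>k. k - 1) ys) = []"
       "dropWhile (\<lambda>k. k < i) (map (\<lambda>k. k - 1) ys) = map (\<lambda>k. k - 1) ys"
    using s(6) by (cases ys; force)+
  then have t: "takeWhile (\<lambda>k. k < i) (remove_row j ks) = xs"
    and d: "dropWhile (\<lambda>k. k < i) (remove_row j ks) = map (\<lambda>k. k - 1) ys"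
    unfolding s(4) using s(5) by (simp_all add: takeWhile_append2 dropWhile_append2)
  have "map (Suc \<circ> (\<lambda>k. k - 1)) ys = ys"
    by (rule map_idI) (use s(6) in force)
  then show "insert_row (ks ! j) (remove_row j ks) = ks"
    unfolding insert_row_def s(3)[symmetric] t d using s(1) by simp
  show "length (takeWhile (\<lambda>k. k < ks ! j) (remove_row j ks)) = j"
    unfolding s(3)[symmetric] t by (rule s(2))
qed

text \<open>The other direction of the bijection: raising the entries that are at least
  \<open>i\<close> opens a gap at \<open>i\<close>, so the list stays strictly increasing when
  \<open>i\<close> is put there.\<close>

lemma insert_row_mem:
  assumes "ls \<in> row_selections (m - 1) (n - 1)" "i < m" "1 \<le> n"
  shows "insert_row i ls \<in> row_selections m n"
    and "length (takeWhile (\<lambda>k. k < i) ls) < n"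
    and "insert_row i ls ! length (takeWhile (\<lambda>k. k < i) ls) = i"
    and "remove_row (length (takeWhile (\<lambda>k. k < i) ls)) (insert_row i ls) = ls"
proof -
  define xs ys where d: "xs = takeWhile (\<lambda>k. k < i) ls" "ys = dropWhile (\<lambda>k. k < i) ls"
  have ls: "ls = xs @ ys" by (simp add: d)
  have x: "\<forall>x\<in>set xs. x < i" by (auto simp: d dest: set_takeWhileD)
  have so: "sorted_wrt (<) xs" "sorted_wrt (<) ys" and len: "length xs + length ys = n - 1"
    and sub: "set xs \<subseteq> {..<m - 1}" "set ys \<subseteq> {..<m - 1}"
    using assms(1) unfolding ls row_selections_def by (auto simp: sorted_wrt_append)
  \<comment> \<open>\<open>dropWhile\<close> controls only the head of \<open>ys\<close>; sortedness
    carries the bound to the rest.\<close>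
  have y: "\<forall>y\<in>set ys. i \<le> y"
  proof (cases ys)
    case (Cons a zs)
    then have "\<not> a < i" using hd_dropWhile[of "\<lambda>k. k < i" ls] d by auto
    then show ?thesis using so(2) Cons by auto
  qed simp
  have ins: "insert_row i ls = xs @ i # map Suc ys" by (simp add: insert_row_def d)
  have "sorted_wrt (<) (insert_row i ls)"
    unfolding ins sorted_wrt_append using so x y by (fastforce simp: sorted_wrt_map)
  then show "insert_row i ls \<in> row_selections m n"
    using len sub assms(2,3) unfolding row_selections_def ins by fastforce
  show "length (takeWhile (\<lambda>k. k < i) ls) < n"
    using len assms(3) unfolding d(1)[symmetric] by simp
  show "insert_row i ls ! length (takeWhile (\<lambda>k. k < i) ls) = i"
    unfolding ins d(1)[symmetric] by simp
  show "remove_row (length (takeWhile (\<lambda>k. k < i) ls)) (insert_row i ls) = ls"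
    unfolding ins d(1)[symmetric] remove_row_def by (simp add: ls o_def)
qed

section \<open>Parity of the sign exponents\<close>

lemma sign_exponent:
  "(\<Sum>j<length ks. Suc (ks ! j) + Suc j) = sum_list ks + (\<Sum>j<length ks. j) + 2 * length ks"
proof -
  have "(\<Sum>j<length ks. Suc (ks ! j) + Suc j) = (\<Sum>j<length ks. ks ! j + j + 2)" by simp
  also have "\<dots> = sum_list ks + (\<Sum>j<length ks. j) + 2 * length ks"
    by (simp only: sum.distrib) (simp add: sum_list_sum_nth atLeast0LessThan)
  finally show ?thesis .
qed

text \<open>Dropping \<open>i = ks ! j\<close> lowers the sum of the entries by \<open>i\<close> and
  by one more for each of the \<open>n - 1 - j\<close> later entries, and the sum of the positions
  by \<open>n - 1\<close>. Once \<open>j\<close>, the exponent of the cofactor sign, is added, the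
  two exponents differ by the even number \<open>2 * (n - 1)\<close>.\<close>

lemma sign_remove_row:
  assumes "ks \<in> row_selections m n" "j < n"
  shows "(-1::real) ^ ((\<Sum>t<n. Suc (ks ! t) + Suc t) + j) =
    (-1) ^ (Suc (ks ! j) + 1 + (\<Sum>t<n - 1. Suc (remove_row j ks ! t) + Suc t))"
proof -
  obtain xs i ys where s: "ks = xs @ i # ys" "length xs = j" "i = ks ! j"
    "remove_row j ks = xs @ map (\<lambda>k. k - 1) ys" "\<forall>y\<in>set ys. i < y"
    by (rule split_row_selection[OF assms]) (rule that; assumption)
  have l: "length ks = n" "length (remove_row j ks) = n - 1"
    using assms remove_row_mem[OF assms] by (simp_all add: row_selections_def)
  have sl: "sum_list ys = sum_list (map (\<lambda>k. k - 1) ys) + length ys"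
    using s(5) by (induction ys) auto
  have n: "n = Suc (j + length ys)" using l(1) s(1,2) by simp
  have "(\<Sum>t<n. Suc (ks ! t) + Suc t) + j =
      Suc (ks ! j) + 1 + (\<Sum>t<n - 1. Suc (remove_row j ks ! t) + Suc t) + 2 * (n - 1)"
  proof -
    have "sum_list ks = sum_list xs + i + sum_list ys" by (simp add: s(1))
    moreover have "sum_list (remove_row j ks) = sum_list xs + sum_list (map (\<lambda>k. k - 1) ys)"
      by (simp add: s(4))
    moreover have "(\<Sum>t<n. t) = (\<Sum>t<n - 1. t) + (n - 1)" by (simp add: n)
    ultimately show ?thesis
      using sign_exponent[of ks] sign_exponent[of "remove_row j ks"] sl n unfolding l s(3) by linarith
  qed
  then show ?thesis by (simp only: power_add power_mult) simp
qed

section \<open>Selecting rows versus deleting rows\<close>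

lemma remove_row_nth:
  assumes "ks \<in> row_selections m n" "j < n" "t < n - 1"
  shows "insert_index (ks ! j) (remove_row j ks ! t) = ks ! insert_index j t"
proof -
  obtain xs i ys where s: "ks = xs @ i # ys" "length xs = j" "i = ks ! j"
    "remove_row j ks = xs @ map (\<lambda>k. k - 1) ys"
    "\<forall>x\<in>set xs. x < i" "\<forall>y\<in>set ys. i < y"
    by (rule split_row_selection[OF assms(1,2)]) (rule that; assumption)
  have l: "n - 1 = length xs + length ys"
    using row_selectionsD(1)[OF assms(1)] s(1) by simp
  show ?thesis
  proof (cases "t < j")
    case True
    then have "xs ! t < i" using s(2,5) by simp
    then show ?thesis
      unfolding s(3)[symmetric] s(4) using True s(1,2) by (simp add: insert_index_def nth_append)
  next
    case False
    \<comment> \<open>From position \<open>j\<close> on, the lowered entry is at least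
      \<open>i\<close>, so \<open>insert_index i\<close> adds back the 1 that was subtracted; on the
      right the position itself shifts to \<open>Suc t\<close>.\<close>
    then have "i < ys ! (t - j)" using s(2,6) l assms(3) by simp
    moreover have "remove_row j ks ! t = ys ! (t - j) - 1"
      unfolding s(4) using False s(2) l assms(3) by (simp add: nth_append)
    moreover have "ks ! Suc t = ys ! (t - j)"
      unfolding s(1) using False s(2) by (simp add: nth_append Suc_diff_le)
    ultimately show ?thesis
      unfolding s(3)[symmetric] using False by (simp add: insert_index_def)
  qed
qed

lemma select_rows_carrier:
  assumes "A \<in> carrier_mat m n" "ks \<in> row_selections m n"
  shows "select_rows A ks \<in> carrier_mat n n"
  using assms by (auto simp: select_rows_def row_selections_def)

lemma index_select_rows:
  assumes "A \<in> carrier_mat m n" "ks \<in> row_selections m k" "r < k" "c < n"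
  shows "select_rows A ks $$ (r, c) = A $$ (ks ! r, c)"
  using assms row_selectionsD[OF assms(2)]
  by (simp add: select_rows_def mat_of_rows_index)

text \<open>Both sides read the same entries of \<open>A\<close>: columns shift by one, and rows
  agree by \<open>remove_row_nth\<close>. This turns the minors in the column expansion of a maximal
  minor of \<open>A\<close> into maximal minors of \<open>A\<close> without row
  \<open>ks ! j\<close> and the first column.\<close>

lemma mat_delete_select_rows:
  assumes A: "A \<in> carrier_mat m n" and ks: "ks \<in> row_selections m n" and j: "j < n"
  shows "mat_delete (select_rows A ks) j 0 = select_rows (mat_delete A (ks ! j) 0) (remove_row j ks)"
proof (rule eq_matI)
  note rm = remove_row_mem[OF ks j]
  have d: "mat_delete A (ks ! j) 0 \<in> carrier_mat (m - 1) (n - 1)"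
    using A by (auto simp: mat_delete_def)
  have sel: "select_rows A ks \<in> carrier_mat n n" by (rule select_rows_carrier[OF A ks])
  have sel': "select_rows (mat_delete A (ks ! j) 0) (remove_row j ks) \<in> carrier_mat (n - 1) (n - 1)"
    by (rule select_rows_carrier[OF d rm])
  show "dim_row (mat_delete (select_rows A ks) j 0) =
      dim_row (select_rows (mat_delete A (ks ! j) 0) (remove_row j ks))"
    "dim_col (mat_delete (select_rows A ks) j 0) =
      dim_col (select_rows (mat_delete A (ks ! j) 0) (remove_row j ks))"
    using sel sel' by auto
  fix r c
  assume "r < dim_row (select_rows (mat_delete A (ks ! j) 0) (remove_row j ks))"
    "c < dim_col (select_rows (mat_delete A (ks ! j) 0) (remove_row j ks))"
  then have r: "r < n - 1" and c: "c < n - 1" using sel' by auto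
  have m: "remove_row j ks ! r < m - 1" by (rule row_selectionsD(2)[OF rm r])
  have "mat_delete (select_rows A ks) j 0 $$ (r, c) = A $$ (ks ! insert_index j r, Suc c)"
    using sel r c index_select_rows[OF A ks, of "insert_index j r" "Suc c"]
    by (auto simp: mat_delete_def insert_index_def)
  also have "\<dots> = A $$ (insert_index (ks ! j) (remove_row j ks ! r), Suc c)"
    by (simp add: remove_row_nth[OF ks j r])
  also have "\<dots> = mat_delete A (ks ! j) 0 $$ (remove_row j ks ! r, c)"
    using A c m by (simp add: mat_delete_def insert_index_def)
  also have "\<dots> = select_rows (mat_delete A (ks ! j) 0) (remove_row j ks) $$ (r, c)"
    by (rule index_select_rows[OF d rm r c, symmetric])
  finally show "mat_delete (select_rows A ks) j 0 $$ (r, c) =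
      select_rows (mat_delete A (ks ! j) 0) (remove_row j ks) $$ (r, c)" .
qed

section \<open>The base case and the Laplace recursion for the minor sum\<close>

lemma minor_sum_single_column:
  assumes "A \<in> carrier_mat m 1"
  shows "minor_sum A = (\<Sum>i<m. (-1) ^ (Suc i + 1) * A $$ (i, 0))"
proof -
  have "minor_sum A = (\<Sum>ks \<in> row_selections m 1. (-1) ^ (Suc (ks ! 0) + 1) * A $$ (ks ! 0, 0))"
    unfolding minor_sum_def using assms
    by (auto intro!: sum.cong
        simp: det_single[OF select_rows_carrier[OF assms]] index_select_rows[OF assms])
  also have "\<dots> = (\<Sum>i<m. (-1) ^ (Suc i + 1) * A $$ (i, 0))"
    unfolding row_selections_one by (subst sum.reindex) (auto simp: inj_on_def)
  finally show ?thesis .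
qed

lemma minor_sum_laplace:
  assumes A: "A \<in> carrier_mat m n" and n: "2 \<le> n"
  shows "minor_sum A = (\<Sum>i<m. (-1) ^ (Suc i + 1) * A $$ (i, 0) * minor_sum (mat_delete A i 0))"
proof -
  let ?R = "row_selections m n" and ?R' = "row_selections (m - 1) (n - 1)"
  let ?e = "\<lambda>n ks. \<Sum>t<n. Suc (ks ! t) + Suc t"
  \<comment> \<open>\<open>?g\<close> is one term of the fully expanded right-hand side, and
    \<open>?h\<close> sends a selection with a marked position to a row and a reduced selection.
    Once the left-hand terms have the form \<open>?g (?h p)\<close>, the reindexing matches them
    termwise by construction.\<close>
  let ?g = "\<lambda>(i, ls). (-1) ^ (Suc i + 1 + ?e (n - 1) ls) * A $$ (i, 0) *
    det (select_rows (mat_delete A i 0) ls)"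
  let ?h = "\<lambda>(ks, j). (ks ! j, remove_row j ks)"
  have "minor_sum A = (\<Sum>ks\<in>?R. \<Sum>j<n. ?g (?h (ks, j)))"
    unfolding minor_sum_def carrier_matD[OF A]
  proof (rule sum.cong[OF refl])
    fix ks assume ks: "ks \<in> ?R"
    have "det (select_rows A ks) = (\<Sum>j<n. select_rows A ks $$ (j, 0) * cofactor (select_rows A ks) j 0)"
      using laplace_expansion_column[OF select_rows_carrier[OF A ks], of 0] n by simp
    also have "\<dots> = (\<Sum>j<n. A $$ (ks ! j, 0) *
        ((-1) ^ j * det (select_rows (mat_delete A (ks ! j) 0) (remove_row j ks))))"
      using n by (intro sum.cong refl)
        (simp add: cofactor_def mat_delete_select_rows[OF A ks] index_select_rows[OF A ks])
    finally show "(-1) ^ ?e n ks * det (select_rows A ks) = (\<Sum>j<n. ?g (?h (ks, j)))"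
    proof (simp only: sum_distrib_left prod.case, intro sum.cong refl)
      fix j assume "j \<in> {..<n}"
      then have sign: "(-1::real) ^ ?e n ks * (-1) ^ j =
          (-1) ^ (Suc (ks ! j) + 1 + ?e (n - 1) (remove_row j ks))"
        using sign_remove_row[OF ks, of j] by (simp only: power_add lessThan_iff)
      show "(-1) ^ ?e n ks * (A $$ (ks ! j, 0) *
          ((-1) ^ j * det (select_rows (mat_delete A (ks ! j) 0) (remove_row j ks)))) =
        (-1) ^ (Suc (ks ! j) + 1 + ?e (n - 1) (remove_row j ks)) * A $$ (ks ! j, 0) *
          det (select_rows (mat_delete A (ks ! j) 0) (remove_row j ks))"
        unfolding sign[symmetric] by (simp only: mult_ac)
    qed
  qed
  also have "\<dots> = (\<Sum>p \<in> ?R \<times> {..<n}. ?g (?h p))"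
    by (subst sum.cartesian_product, rule sum.cong[OF refl]) (simp only: split_paired_all prod.case)
  also have "\<dots> = (\<Sum>p \<in> {..<m} \<times> ?R'. ?g p)"
  \<comment> \<open>Here \<open>j\<close> and \<open>i\<close> name the two inverse maps of the
    rule. The marked position is recovered as the number of entries of \<open>ls\<close> below the
    inserted row.\<close>
  proof (rule sum.reindex_bij_witness[where j = ?h and
        i = "\<lambda>(i, ls). (insert_row i ls, length (takeWhile (\<lambda>k. k < i) ls))"])
    fix p assume "p \<in> ?R \<times> {..<n}"
    then obtain ks j where p: "p = (ks, j)" "ks \<in> ?R" "j < n" by auto
    show "(\<lambda>(i, ls). (insert_row i ls, length (takeWhile (\<lambda>k. k < i) ls))) (?h p) = p"
      using p insert_row_remove_row[OF p(2,3)] by simp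
    show "?h p \<in> {..<m} \<times> ?R'"
      using p remove_row_mem[OF p(2,3)] row_selectionsD(2)[OF p(2,3)] by simp
  next
    fix q assume "q \<in> {..<m} \<times> ?R'"
    then obtain i ls where q: "q = (i, ls)" "i < m" "ls \<in> ?R'" by auto
    note ins = insert_row_mem[OF q(3,2)]
    show "?h ((\<lambda>(i, ls). (insert_row i ls, length (takeWhile (\<lambda>k. k < i) ls))) q) = q"
      "(\<lambda>(i, ls). (insert_row i ls, length (takeWhile (\<lambda>k. k < i) ls))) q \<in> ?R \<times> {..<n}"
      using q n ins by simp_all
  qed simp
  also have "\<dots> = (\<Sum>i<m. \<Sum>ls\<in>?R'. ?g (i, ls))"
    by (subst sum.cartesian_product, rule sum.cong[OF refl]) (simp only: split_paired_all prod.case)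
  also have "\<dots> = (\<Sum>i<m. (-1) ^ (Suc i + 1) * A $$ (i, 0) * minor_sum (mat_delete A i 0))"
    unfolding minor_sum_def mat_delete_dim carrier_matD[OF A] sum_distrib_left
    by (intro sum.cong refl) (simp only: prod.case power_add mult_ac)
  finally show ?thesis .
qed

section \<open>Existence and uniqueness\<close>

lemma tall_mats_iff: "A \<in> carrier_mat m n \<Longrightarrow> A \<in> tall_mats \<longleftrightarrow> 1 \<le> n \<and> n \<le> m"
  by (auto simp: tall_mats_def)

lemma is_gdet_minor_sum: "is_gdet (restrict minor_sum tall_mats)"
  unfolding is_gdet_def
proof (intro conjI)
  show "gdet_base (restrict minor_sum tall_mats)"
    unfolding gdet_base_def
    using minor_sum_single_column by (auto simp: tall_mats_iff)
  show "gdet_laplace (restrict minor_sum tall_mats)"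
    unfolding gdet_laplace_def
  proof (intro allI impI ballI)
    fix m n and A :: "real mat"
    assume mn: "n \<le> m" "2 \<le> n" and A: "A \<in> carrier_mat m n"
    \<comment> \<open>Since \<open>n \<ge> 2\<close>, the smaller matrix still has a column, so
      \<open>restrict\<close> returns \<open>minor_sum\<close> there and not
      \<open>undefined\<close>.\<close>
    have d: "mat_delete A i 0 \<in> tall_mats" for i
      using mn A by (auto simp: tall_mats_def)
    show "restrict minor_sum tall_mats A = (\<Sum>i<m. (-1) ^ (Suc i + 1) * A $$ (i, 0) *
        restrict minor_sum tall_mats (mat_delete A i 0))"
      using minor_sum_laplace[OF A mn(2)] mn d by (simp add: tall_mats_iff[OF A])
  qed
qed simp

text \<open>Both functions obey the same recursion, which lowers the number of columns by one. The
  induction starts at one column and keeps \<open>m\<close> and \<open>A\<close> general, because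
  deletion changes both; \<open>Suc n \<le> m\<close> yields \<open>n \<le> m - 1\<close>, so the
  hypothesis applies.\<close>

lemma is_gdet_eq_minor_sum:
  assumes "is_gdet f" "A \<in> carrier_mat m n" "n \<le> m" "1 \<le> n"
  shows "f A = minor_sum A"
  using assms(4,2,3)
proof (induction n arbitrary: m A rule: dec_induct)
  case base
  then show ?case
    using assms(1) minor_sum_single_column[of A m] by (simp add: is_gdet_def gdet_base_def)
next
  case (step n)
  have "f A = (\<Sum>i<m. (-1) ^ (Suc i + 1) * A $$ (i, 0) * f (mat_delete A i 0))"
    using assms(1) step.hyps step.prems unfolding is_gdet_def gdet_laplace_def by auto
  also have "\<dots> = (\<Sum>i<m. (-1) ^ (Suc i + 1) * A $$ (i, 0) * minor_sum (mat_delete A i 0))"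
  proof (intro sum.cong refl)
    fix i
    have "mat_delete A i 0 \<in> carrier_mat (m - 1) n" using step.prems(1) by (simp add: mat_delete_def)
    then have "f (mat_delete A i 0) = minor_sum (mat_delete A i 0)"
      using step.prems(2) by (intro step.IH) auto
    then show "(-1) ^ (Suc i + 1) * A $$ (i, 0) * f (mat_delete A i 0) =
        (-1) ^ (Suc i + 1) * A $$ (i, 0) * minor_sum (mat_delete A i 0)" by simp
  qed
  also have "\<dots> = minor_sum A"
    using minor_sum_laplace[OF step.prems(1)] step.hyps(1) by simp
  finally show ?case .
qed

theorem theorem4p1:
  "(\<exists>!gdet. is_gdet gdet) \<and>
   (\<forall>gdet. is_gdet gdet \<longrightarrow>
      (\<forall>m n. \<forall>A \<in> carrier_mat m n. m \<ge> n \<longrightarrow> n \<ge> 1 \<longrightarrow>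
         gdet A = (\<Sum>ks \<in> row_selections m n.
           (-1) ^ (\<Sum>j<n. Suc (ks ! j) + Suc j) * det (select_rows A ks))))"
proof (intro conjI allI impI ballI)
  show "\<exists>!gdet. is_gdet gdet"
  proof (rule ex1I, rule is_gdet_minor_sum)
    fix f assume f: "is_gdet f"
    show "f = restrict minor_sum tall_mats"
    \<comment> \<open>Both functions are \<open>undefined\<close> outside \<open>tall_mats\<close>,
      so agreement on that set gives equality.\<close>
    proof (rule PiE_ext)
      show "f \<in> tall_mats \<rightarrow>\<^sub>E UNIV" using f by (simp add: is_gdet_def)
      show "restrict minor_sum tall_mats \<in> tall_mats \<rightarrow>\<^sub>E UNIV" by simp
      fix A assume "A \<in> tall_mats"
      then show "f A = restrict minor_sum tall_mats A"
        using is_gdet_eq_minor_sum[OF f, of A "dim_row A" "dim_col A"]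
        by (simp add: tall_mats_def)
    qed
  qed
next
  fix f m n and A :: "real mat"
  assume "is_gdet f" "A \<in> carrier_mat m n" "n \<le> m" "1 \<le> n"
  then show "f A = (\<Sum>ks \<in> row_selections m n.
      (-1) ^ (\<Sum>j<n. Suc (ks ! j) + Suc j) * det (select_rows A ks))"
    using is_gdet_eq_minor_sum[of f A m n] by (simp add: minor_sum_def)
qed

end
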